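(* Let $m\ge 3$, let $\mathcal S\in T^m(\mathbb R^p)$, and let $(\lambda,\mathbf v)$ be an eigenpair of $\mathcal S$ with $\lambda>0$. Let $$\mathbf K=\mathbf P_{\mathbf v}^{\bot}\big[(m-1)\mathcal S\mathbf v^{m-2}-\lambda\mathbf I_p\big]\mathbf P_{\mathbf v}^{\bot},\qquad \mathbf P_{\mathbf v}^{\bot}=\mathbf I_p-\mathbf v\mathbf v^{\mathrm T},\qquad \mathbf J=\frac{m-1}{\lambda}\big(\mathcal S\mathbf v^{m-2}-\lambda\mathbf v\mathbf v^{\mathrm T}\big).$$ Then: (1) If $\mathbf K\succeq 0$, then $\rho(\mathbf J)\ge 1$. (2) If $\mathbf K$ is indefinite, then $\rho(\mathbf J)\ge 1$. (3) If $\mathbf K\preceq 0$ and two extra conditions hold, namely (i) $\mathbf K$ has only one zero eigenvalue and (ii) the remaining nonzero eigenvalues of $\mathbf K$ lie in the open interval $(-2\lambda,0)$, then $\rho(\mathbf J)<1$. (4) Conversely to (3), if $\rho(\mathbf J)<1$, then $\mathbf K\preceq 0$.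
   Context: $T^m(\mathbb R^{p})$ is the space of real symmetric tensors of order $m$ and dimension $p$. For $\mathcal S\in T^m(\mathbb R^p)$ and $\mathbf v\in\mathbb R^p$: $\mathcal S\mathbf v^{m-1}\in\mathbb R^p$ has $j$th entry $\sum_{i_2,\dots,i_m}s_{j,i_2,\dots,i_m}v_{i_2}\cdots v_{i_m}$; $\mathcal S\mathbf v^{m-2}\in\mathbb R^{p\times p}$ has $(i,j)$ entry $\sum_{i_3,\dots,i_m}s_{i,j,i_3,\dots,i_m}v_{i_3}\cdots v_{i_m}$. An eigenpair is a real pair $(\lambda,\mathbf v)$ with $\mathcal S\mathbf v^{m-1}=\lambda\mathbf v$ and $\mathbf v^{\mathrm T}\mathbf v=1$. $\rho(\cdot)$ is the spectral radius (maximum absolute value of the eigenvalues); $\succeq0$, $\preceq0$ denote positive/negative semidefiniteness; a symmetric matrix is indefinite if it has both a positive and a negative eigenvalue. Eigenvalues are counted with multiplicity.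
   Formalization: Part (1) is stated for p ≥ 2 only; for p = 1 it is always false, since then the projector is 0, K = 0 is positive semidefinite, and J = 0 has spectral radius 0 < 1. *)

theory Defs
  imports "Jordan_Normal_Form.Spectral_Radius" "HOL-Combinatorics.Permutations"
begin

(* Indices run over 0, ..., p - 1. *)
definition multi_indices :: "nat \<Rightarrow> nat \<Rightarrow> nat list set" where
  "multi_indices k p = {is. length is = k \<and> set is \<subseteq> {..<p}}"

(* A tensor of order m and dimension p is a function on index lists; only its values on
   multi_indices m p are meaningful. *)
definition symmetric_tensor :: "nat \<Rightarrow> nat \<Rightarrow> (nat list \<Rightarrow> real) \<Rightarrow> bool" where
  "symmetric_tensor m p S \<longleftrightarrow>
     (\<forall>is \<in> multi_indices m p. \<forall>\<pi>. \<pi> permutes {..<m} \<longrightarrow> S (permute_list \<pi> is) = S is)"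

(* S v^(m-1) *)
definition tensor_vec :: "nat \<Rightarrow> nat \<Rightarrow> (nat list \<Rightarrow> real) \<Rightarrow> real vec \<Rightarrow> real vec" where
  "tensor_vec m p S v =
     vec p (\<lambda>j. \<Sum>is \<in> multi_indices (m - 1) p. S (j # is) * (\<Prod>i\<leftarrow>is. v $ i))"

(* S v^(m-2) *)
definition tensor_mat :: "nat \<Rightarrow> nat \<Rightarrow> (nat list \<Rightarrow> real) \<Rightarrow> real vec \<Rightarrow> real mat" where
  "tensor_mat m p S v =
     mat p p (\<lambda>(i, j). \<Sum>is \<in> multi_indices (m - 2) p. S (i # j # is) * (\<Prod>k\<leftarrow>is. v $ k))"

definition tensor_eigenpair ::
    "nat \<Rightarrow> nat \<Rightarrow> (nat list \<Rightarrow> real) \<Rightarrow> real \<Rightarrow> real vec \<Rightarrow> bool" where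
  "tensor_eigenpair m p S l v \<longleftrightarrow>
     v \<in> carrier_vec p \<and> tensor_vec m p S v = l \<cdot>\<^sub>v v \<and> v \<bullet> v = 1"

(* The p x p matrix v v^T *)
definition outer_square :: "nat \<Rightarrow> real vec \<Rightarrow> real mat" where
  "outer_square p v = mat p p (\<lambda>(i, j). v $ i * v $ j)"

definition perp_projection :: "nat \<Rightarrow> real vec \<Rightarrow> real mat" where
  "perp_projection p v = 1\<^sub>m p - outer_square p v"

definition symmetric_matrix :: "real mat \<Rightarrow> bool" where
  "symmetric_matrix A \<longleftrightarrow> transpose_mat A = A"

definition pos_semidef :: "real mat \<Rightarrow> bool" where
  "pos_semidef A \<longleftrightarrow> symmetric_matrix A \<and> (\<forall>x \<in> carrier_vec (dim_row A). 0 \<le> x \<bullet> (A *\<^sub>v x))"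

definition neg_semidef :: "real mat \<Rightarrow> bool" where
  "neg_semidef A \<longleftrightarrow> symmetric_matrix A \<and> (\<forall>x \<in> carrier_vec (dim_row A). x \<bullet> (A *\<^sub>v x) \<le> 0)"

definition indefinite :: "real mat \<Rightarrow> bool" where
  "indefinite A \<longleftrightarrow> symmetric_matrix A \<and> (\<exists>\<mu>>0. eigenvalue A \<mu>) \<and> (\<exists>\<mu><0. eigenvalue A \<mu>)"

(* Algebraic multiplicity; 0 if \<mu> is not an eigenvalue. *)
definition eigenvalue_multiplicity :: "real mat \<Rightarrow> real \<Rightarrow> nat" where
  "eigenvalue_multiplicity A \<mu> = order \<mu> (char_poly A)"

(* The library's spectral radius is defined for complex matrices only. *)
definition real_spectral_radius :: "real mat \<Rightarrow> real" where
  "real_spectral_radius A = spectral_radius (map_mat complex_of_real A)"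

end

theory Submission
  imports Defs
begin

text \<open>Since \<open>S v^(m-2)\<close> maps \<open>v\<close> to \<open>\<lambda> v\<close>, we have \<open>\<lambda> J = K + \<lambda> P\<close>, \<open>J v = K v = 0\<close>
  and \<open>J\<close> is symmetric. The spectral theorem is avoided: if \<open>\<rho>(J) < 1\<close>, the powers of \<open>J\<close> are
  bounded, and a symmetric matrix with bounded powers satisfies \<open>|J x| \<le> |x|\<close>; hence
  \<open>x \<bullet> K x = \<lambda> (y \<bullet> J y - y \<bullet> y) \<le> 0\<close> for \<open>y = P x\<close>. This gives (4) and (2). In (1), \<open>\<rho>(J) < 1\<close> would
  give a nonzero \<open>w\<close> orthogonal to \<open>v\<close> with \<open>w \<bullet> J w = w \<bullet> w\<close>, which forces \<open>J w = w\<close>. For (3), an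
  eigenvalue \<open>c \<noteq> 0\<close> of \<open>J\<close> has an eigenvector orthogonal to \<open>v\<close>, so \<open>\<lambda> (c - 1)\<close> is an eigenvalue
  of \<open>K\<close>, and \<open>c = 1\<close> would make the kernel of \<open>K\<close> two-dimensional.\<close>

section \<open>The Euclidean inner product on real vectors\<close>

lemma scalar_prod_self_eq_0_iff:
  fixes x :: "real vec"
  assumes "x \<in> carrier_vec n"
  shows "x \<bullet> x = 0 \<longleftrightarrow> x = 0\<^sub>v n"
proof
  assume "x \<bullet> x = 0"
  hence "\<forall>i\<in>{0..<dim_vec x}. x $ i * x $ i = 0"
    unfolding scalar_prod_def by (subst (asm) sum_nonneg_eq_0_iff) auto
  thus "x = 0\<^sub>v n" using assms by (intro eq_vecI) auto
qed (use assms in auto)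

lemma scalar_prod_self_nonneg: "0 \<le> x \<bullet> x" for x :: "real vec"
  unfolding scalar_prod_def by (rule sum_nonneg) auto

lemma scalar_prod_diff_self:
  fixes x y :: "real vec"
  assumes x: "x \<in> carrier_vec n" and y: "y \<in> carrier_vec n"
  shows "(x - y) \<bullet> (x - y) = x \<bullet> x - 2 * (x \<bullet> y) + y \<bullet> y"
  using x y comm_scalar_prod[OF x y]
  by (simp add: scalar_prod_minus_distrib[of _ n] minus_scalar_prod_distrib[of _ n])

lemma scalar_prod_Cauchy:
  fixes x y :: "real vec"
  assumes x: "x \<in> carrier_vec n" and y: "y \<in> carrier_vec n"
  shows "(x \<bullet> y)\<^sup>2 \<le> (x \<bullet> x) * (y \<bullet> y)"
proof (cases "y = 0\<^sub>v n")
  case True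
  thus ?thesis using x by simp
next
  case False
  hence pos: "0 < y \<bullet> y"
    using scalar_prod_self_eq_0_iff[OF y] scalar_prod_self_nonneg[of y] by linarith
  \<comment> \<open>The vector is \<open>y \<bullet> y\<close> times the component of x orthogonal
    to y; scaling the projection this way avoids division.\<close>
  have "0 \<le> ((y \<bullet> y) \<cdot>\<^sub>v x - (x \<bullet> y) \<cdot>\<^sub>v y) \<bullet> ((y \<bullet> y) \<cdot>\<^sub>v x - (x \<bullet> y) \<cdot>\<^sub>v y)"
    by (rule scalar_prod_self_nonneg)
  also have "\<dots> = (y \<bullet> y) * ((x \<bullet> x) * (y \<bullet> y) - (x \<bullet> y)\<^sup>2)"
    by (subst scalar_prod_diff_self[of _ n]) (use x y in \<open>auto simp: power2_eq_square algebra_simps\<close>)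
  finally show ?thesis using pos by (simp add: zero_le_mult_iff)
qed

section \<open>Symmetric matrices with bounded powers\<close>

lemma symmetric_matrix_scalar_prod:
  assumes A: "A \<in> carrier_mat n n" and s: "symmetric_matrix A"
    and x: "x \<in> carrier_vec n" and y: "y \<in> carrier_vec n"
  shows "x \<bullet> (A *\<^sub>v y) = (A *\<^sub>v x) \<bullet> y"
proof -
  have "x \<bullet> (A *\<^sub>v y) = (transpose_mat A *\<^sub>v x) \<bullet> y"
    using transpose_vec_mult_scalar[OF A y x] by simp
  thus ?thesis using s by (simp add: symmetric_matrix_def)
qed

text \<open>Iterating the map gives the recursion with A applied on the left, while the matrix power
  gives access to entry bounds; the proof below switches between the two views.\<close>

lemma funpow_mult_mat_vec:
  assumes A: "A \<in> carrier_mat n n" and x: "x \<in> carrier_vec n"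
  shows "(((*\<^sub>v) A) ^^ k) x = A ^\<^sub>m k *\<^sub>v x"
  using x
proof (induction k arbitrary: x)
  case (Suc k)
  have "(((*\<^sub>v) A) ^^ Suc k) x = (((*\<^sub>v) A) ^^ k) (A *\<^sub>v x)"
    by (simp only: funpow_Suc_right o_apply)
  also have "\<dots> = A ^\<^sub>m k *\<^sub>v (A *\<^sub>v x)" using Suc A by simp
  also have "\<dots> = A ^\<^sub>m Suc k *\<^sub>v x"
    using A Suc.prems assoc_mult_mat_vec[OF pow_carrier_mat[OF A, of k] A Suc.prems] by simp
  finally show ?case .
qed (use A in simp)

text \<open>By Cauchy-Schwarz the sequence \<open>q k = |A\<^sup>k x|\<^sup>2\<close> is log-convex, so \<open>q 1 > q 0\<close> would make it
  grow geometrically.\<close>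

lemma symmetric_power_bounded_imp_contraction:
  assumes A: "A \<in> carrier_mat n n" and s: "symmetric_matrix A"
    and bd: "\<And>k. norm_bound (A ^\<^sub>m k) c" and x: "x \<in> carrier_vec n"
  shows "(A *\<^sub>v x) \<bullet> (A *\<^sub>v x) \<le> x \<bullet> x"
proof (rule ccontr)
  assume "\<not> ?thesis"
  hence gt: "x \<bullet> x < (A *\<^sub>v x) \<bullet> (A *\<^sub>v x)" by simp
  define y where "y k = (((*\<^sub>v) A) ^^ k) x" for k
  define q where "q k = y k \<bullet> y k" for k
  have yc: "y k \<in> carrier_vec n" for k
    unfolding y_def funpow_mult_mat_vec[OF A x]
    using mult_mat_vec_carrier[OF pow_carrier_mat[OF A] x] .
  have yS: "y (Suc k) = A *\<^sub>v y k" for k by (simp add: y_def)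
  have q01: "q 0 < q 1" using gt by (simp add: q_def y_def)
  have "A *\<^sub>v 0\<^sub>v n = 0\<^sub>v n" using A by (intro eq_vecI) auto
  hence "x \<noteq> 0\<^sub>v n" using gt by auto
  hence q0: "0 < q 0"
    using scalar_prod_self_eq_0_iff[OF x] scalar_prod_self_nonneg[of x] by (simp add: q_def y_def)
  \<comment> \<open>By symmetry one factor A moves across the inner product, so
    \<open>q (Suc k)\<close> is the product of the iterates k and k + 2, to which Cauchy-Schwarz
    applies.\<close>
  have lc: "(q (Suc k))\<^sup>2 \<le> q k * q (Suc (Suc k))" for k
  proof -
    have "q (Suc k) = y k \<bullet> y (Suc (Suc k))"
      unfolding q_def yS using symmetric_matrix_scalar_prod[OF A s yc yc[of "Suc k"], of k]
      by (simp add: yS)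
    thus ?thesis using scalar_prod_Cauchy[OF yc yc, of k "Suc (Suc k)"] by (simp add: q_def)
  qed
  define r where "r = q 1 / q 0"
  have r: "1 < r" using q01 q0 by (simp add: r_def)
  \<comment> \<open>Log-convexity keeps the ratio of consecutive terms at least r. Positivity is
    carried along so that \<open>q k\<close> can be cancelled.\<close>
  have step: "0 < q k \<and> r * q k \<le> q (Suc k)" for k
  proof (induction k)
    case 0
    thus ?case using q0 by (simp add: r_def)
  next
    case (Suc k)
    hence k: "0 < q k" "r * q k \<le> q (Suc k)" by auto
    have p: "0 < q (Suc k)" using k r by (smt (verit) mult_pos_pos)
    have "q k * (r * q (Suc k)) \<le> (q (Suc k))\<^sup>2"
      using mult_right_mono[OF k(2), of "q (Suc k)"] p
      by (simp add: power2_eq_square algebra_simps)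
    also have "\<dots> \<le> q k * q (Suc (Suc k))" by (rule lc)
    finally show ?case using k(1) p by simp
  qed
  have grow: "r ^ k * q 0 \<le> q k" for k
  proof (induction k)
    case (Suc k)
    have "r ^ Suc k * q 0 = r * (r ^ k * q 0)" by simp
    also have "\<dots> \<le> r * q k" using Suc r by (intro mult_left_mono) auto
    also have "\<dots> \<le> q (Suc k)" using step by simp
    finally show ?case .
  qed simp
  \<comment> \<open>\<open>norm_bound\<close> bounds each entry of each power by c, so C bounds
    every entry of every iterate, independently of k.\<close>
  define C where "C = c * (\<Sum>j<n. \<bar>x $ j\<bar>)"
  have entry: "\<bar>y k $ i\<bar> \<le> C" if i: "i < n" for k i
  proof -
    have "y k $ i = (\<Sum>j<n. (A ^\<^sub>m k) $$ (i, j) * x $ j)"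
      unfolding y_def funpow_mult_mat_vec[OF A x]
      using A x i by (simp add: scalar_prod_def atLeast0LessThan)
    also have "\<bar>\<dots>\<bar> \<le> (\<Sum>j<n. c * \<bar>x $ j\<bar>)"
    proof (rule order.trans[OF sum_abs], rule sum_mono)
      fix j assume "j \<in> {..<n}"
      hence "\<bar>(A ^\<^sub>m k) $$ (i, j)\<bar> \<le> c"
        using bd[of k] A i by (simp add: norm_bound_def)
      thus "\<bar>(A ^\<^sub>m k) $$ (i, j) * x $ j\<bar> \<le> c * \<bar>x $ j\<bar>"
        by (simp add: abs_mult mult_right_mono)
    qed
    finally show ?thesis by (simp add: C_def sum_distrib_left)
  qed
  have qb: "q k \<le> real n * C\<^sup>2" for k
  proof -
    have "q k = (\<Sum>i<n. (y k $ i)\<^sup>2)"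
      unfolding q_def scalar_prod_def using yc[of k]
      by (simp add: power2_eq_square atLeast0LessThan)
    also have "\<dots> \<le> (\<Sum>i<n. C\<^sup>2)"
      using entry by (intro sum_mono) (metis abs_le_square_iff abs_ge_self lessThan_iff order_trans)
    finally show ?thesis by simp
  qed
  obtain k where "real n * C\<^sup>2 / q 0 < r ^ k" using real_arch_pow[OF r] by blast
  hence "real n * C\<^sup>2 < r ^ k * q 0" using q0 by (simp add: field_simps)
  with grow[of k] qb[of k] show False by linarith
qed

section \<open>The spectral radius of a real symmetric matrix\<close>

lemma eigenvalue_abs_le_real_spectral_radius:
  assumes A: "A \<in> carrier_mat n n" and e: "eigenvalue A c"
  shows "\<bar>c\<bar> \<le> real_spectral_radius A"
proof -
  have n: "0 < n" using eigenvalue_imp_nonzero_dim[OF A e] .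
  have "eigenvalue (map_mat complex_of_real A) (complex_of_real c)"
    using of_real_hom.eigenvalue_hom[OF A e] .
  hence "norm (complex_of_real c) \<le> real_spectral_radius A"
    unfolding real_spectral_radius_def
    using A n by (intro spectral_radius_mem_max(2)[of _ n] imageI) (auto simp: spectrum_def)
  thus ?thesis by simp
qed

text \<open>The Jordan normal form bounds the powers of the complexified matrix uniformly when its
  spectral radius is below 1. Embedding the reals preserves powers and absolute values, so the same
  bound holds for A.\<close>

lemma real_spectral_radius_less_1_imp_contraction:
  assumes A: "A \<in> carrier_mat n n" and s: "symmetric_matrix A"
    and rho: "real_spectral_radius A < 1" and x: "x \<in> carrier_vec n"
  shows "(A *\<^sub>v x) \<bullet> (A *\<^sub>v x) \<le> x \<bullet> x"
proof -
  let ?A = "map_mat complex_of_real A"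
  have cA: "?A \<in> carrier_mat n n" using A by simp
  obtain c where c: "\<And>k. norm_bound (?A ^\<^sub>m k) c"
    using spectral_radius_jnf_norm_bound_less_1_upper_triangular[OF cA]
      rho[unfolded real_spectral_radius_def] by blast
  have "norm_bound (A ^\<^sub>m k) c" for k
    using c[of k] A unfolding of_real_hom.mat_hom_pow[OF A, symmetric] norm_bound_def by auto
  thus ?thesis by (rule symmetric_power_bounded_imp_contraction[OF A s _ x])
qed

text \<open>Split a complex eigenvector as z = a + i b. Symmetry equates
  \<open>a \<bullet> (A *\<^sub>v b)\<close> with \<open>(A *\<^sub>v a) \<bullet> b\<close>, which
  forces Im c (|a|^2 + |b|^2) = 0. Then whichever of a and b is nonzero is a real
  eigenvector.\<close>

lemma symmetric_complex_eigenvalue_real: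
  assumes A: "A \<in> carrier_mat n n" and s: "symmetric_matrix A"
    and e: "eigenvalue (map_mat complex_of_real A) c"
  shows "\<exists>t. c = complex_of_real t \<and> eigenvalue A t"
proof -
  let ?A = "map_mat complex_of_real A"
  obtain z where z: "z \<in> carrier_vec n" "z \<noteq> 0\<^sub>v n" and Az: "?A *\<^sub>v z = c \<cdot>\<^sub>v z"
    using e A unfolding eigenvalue_def eigenvector_def by auto
  define a where "a = map_vec Re z"
  define b where "b = map_vec Im z"
  have a: "a \<in> carrier_vec n" and b: "b \<in> carrier_vec n" using z by (auto simp: a_def b_def)
  have comp: "(\<Sum>j\<in>{0..<n}. complex_of_real (A $$ (i, j)) * z $ j) = c * z $ i" if "i < n" for i
    using arg_cong[OF Az, of "\<lambda>u. u $ i"] that A z by (simp add: scalar_prod_def)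
  \<comment> \<open>Real and, below, imaginary part of A z = c z, read off componentwise.\<close>
  have Aa: "A *\<^sub>v a = Re c \<cdot>\<^sub>v a - Im c \<cdot>\<^sub>v b"
  proof (intro eq_vecI)
    fix i assume "i < dim_vec (Re c \<cdot>\<^sub>v a - Im c \<cdot>\<^sub>v b)"
    hence i: "i < n" using b by simp
    from arg_cong[OF comp[OF i], of Re]
    show "(A *\<^sub>v a) $ i = (Re c \<cdot>\<^sub>v a - Im c \<cdot>\<^sub>v b) $ i"
      using i A z by (simp add: scalar_prod_def a_def b_def)
  qed (use A b in auto)
  have Ab: "A *\<^sub>v b = Re c \<cdot>\<^sub>v b + Im c \<cdot>\<^sub>v a"
  proof (intro eq_vecI)
    fix i assume "i < dim_vec (Re c \<cdot>\<^sub>v b + Im c \<cdot>\<^sub>v a)"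
    hence i: "i < n" using a by simp
    from arg_cong[OF comp[OF i], of Im]
    show "(A *\<^sub>v b) $ i = (Re c \<cdot>\<^sub>v b + Im c \<cdot>\<^sub>v a) $ i"
      using i A z by (simp add: scalar_prod_def a_def b_def)
  qed (use A a in auto)
  have "a \<noteq> 0\<^sub>v n \<or> b \<noteq> 0\<^sub>v n"
  proof (rule ccontr)
    assume "\<not> ?thesis"
    hence ab: "a = 0\<^sub>v n" "b = 0\<^sub>v n" by auto
    have "z = 0\<^sub>v n"
    proof (intro eq_vecI)
      fix i assume "i < dim_vec (0\<^sub>v n :: complex vec)"
      hence i: "i < n" by simp
      hence "a $ i = 0" "b $ i = 0" using ab by auto
      thus "z $ i = 0\<^sub>v n $ i" using i z by (simp add: a_def b_def complex_eq_iff)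
    qed (use z in simp)
    with z show False by simp
  qed
  note nz = this
  have "a \<bullet> (A *\<^sub>v b) = (A *\<^sub>v a) \<bullet> b" by (rule symmetric_matrix_scalar_prod[OF A s a b])
  hence "Re c * (a \<bullet> b) + Im c * (a \<bullet> a) = Re c * (a \<bullet> b) - Im c * (b \<bullet> b)"
    unfolding Aa Ab using a b
    by (simp add: scalar_prod_add_distrib[of _ n] minus_scalar_prod_distrib[of _ n])
  hence "Im c * (a \<bullet> a + b \<bullet> b) = 0" by (simp add: algebra_simps)
  moreover have "a \<bullet> a + b \<bullet> b \<noteq> 0"
    using nz scalar_prod_self_eq_0_iff[OF a] scalar_prod_self_eq_0_iff[OF b]
      scalar_prod_self_nonneg[of a] scalar_prod_self_nonneg[of b]
    by (metis add_nonneg_eq_0_iff)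
  ultimately have im: "Im c = 0" by simp
  have "A *\<^sub>v a = Re c \<cdot>\<^sub>v a" "A *\<^sub>v b = Re c \<cdot>\<^sub>v b"
    unfolding Aa Ab im using a b by auto
  hence "eigenvalue A (Re c)" using nz a b A unfolding eigenvalue_def eigenvector_def by auto
  moreover have "c = complex_of_real (Re c)" using im by (simp add: complex_eq_iff)
  ultimately show ?thesis by blast
qed

text \<open>The spectral radius is attained at a complex eigenvalue, which symmetry makes real; a
  positive dimension keeps the spectrum nonempty.\<close>

lemma real_spectral_radius_eigenvalue:
  assumes A: "A \<in> carrier_mat n n" and s: "symmetric_matrix A" and n: "0 < n"
  obtains c where "eigenvalue A c" "real_spectral_radius A = \<bar>c\<bar>"
proof -
  have "real_spectral_radius A \<in> norm ` spectrum (map_mat complex_of_real A)"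
    unfolding real_spectral_radius_def by (rule spectral_radius_mem_max(1)[of _ n]) (use A n in auto)
  then obtain z where "real_spectral_radius A = norm z" "eigenvalue (map_mat complex_of_real A) z"
    by (auto simp: spectrum_def)
  with symmetric_complex_eigenvalue_real[OF A s] that show thesis by fastforce
qed

section \<open>Geometric multiplicity two forces algebraic multiplicity at least two\<close>

text \<open>Since x vanishes at i, column i contributes nothing to A x, so x with entry i removed
  satisfies the eigenvector equation of the principal submatrix and is still nonzero.\<close>

lemma eigenvalue_mat_delete:
  fixes A :: "'a :: field mat"
  assumes A: "A \<in> carrier_mat n n" and e: "eigenvector A x c" and i: "i < n" and xi: "x $ i = 0"
  shows "eigenvalue (mat_delete A i i) c"
proof -
  obtain N where N: "n = Suc N" using i by (cases n) auto
  have x: "x \<in> carrier_vec n" "x \<noteq> 0\<^sub>v n" and Ax: "A *\<^sub>v x = c \<cdot>\<^sub>v x"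
    using e A by (auto simp: eigenvector_def)
  \<comment> \<open>\<open>insert_index i\<close> enumerates the indices other than i in increasing
    order.\<close>
  define y where "y = vec N (\<lambda>k. x $ insert_index i k)"
  have ins: "insert_index i k < n" if "k < N" for k
    using that N by (auto simp: insert_index_def)
  have "mat_delete A i i *\<^sub>v y = c \<cdot>\<^sub>v y"
  proof (intro eq_vecI)
    fix r assume "r < dim_vec (c \<cdot>\<^sub>v y)"
    hence r: "r < N" by (simp add: y_def)
    have "(mat_delete A i i *\<^sub>v y) $ r
        = (\<Sum>k\<in>{0..<N}. A $$ (insert_index i r, insert_index i k) * x $ insert_index i k)"
      using r N A by (auto simp: scalar_prod_def y_def mat_delete_def insert_index_def intro!: sum.cong)
    also have "\<dots> = (\<Sum>j\<in>insert_index i ` {0..<N}. A $$ (insert_index i r, j) * x $ j)"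
      by (simp add: sum.reindex insert_index_inj_on)
    \<comment> \<open>The range of \<open>insert_index i\<close> misses only i, whose term is 0
      because \<open>x $ i = 0\<close>.\<close>
    also have "\<dots> = (\<Sum>j\<in>{0..<n}. A $$ (insert_index i r, j) * x $ j)"
      using i N xi by (subst insert_index_image) (auto simp del: sum.op_ivl_Suc intro!: sum.mono_neutral_left)
    also have "\<dots> = (A *\<^sub>v x) $ insert_index i r"
      using ins[OF r] A x by (simp add: scalar_prod_def)
    finally show "(mat_delete A i i *\<^sub>v y) $ r = (c \<cdot>\<^sub>v y) $ r"
      using ins[OF r] r x by (simp add: Ax y_def)
  qed (use A N in \<open>simp add: y_def\<close>)
  moreover have "y \<noteq> 0\<^sub>v N"
  proof
    assume y0: "y = 0\<^sub>v N"
    have "x = 0\<^sub>v n"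
    proof (intro eq_vecI)
      fix j assume "j < dim_vec (0\<^sub>v n :: 'a vec)"
      hence j: "j < n" by simp
      show "x $ j = 0\<^sub>v n $ j"
      proof (cases "j = i")
        case False
        hence "j \<in> insert_index i ` {0..<N}" using j i N by (subst insert_index_image) auto
        then obtain k where k: "k < N" "j = insert_index i k" by auto
        have "y $ k = 0" using y0 k by simp
        thus ?thesis using k j by (simp add: y_def)
      qed (use xi j in simp)
    qed (use x in simp)
    with x show False by simp
  qed
  ultimately show ?thesis
    using A N unfolding eigenvalue_def eigenvector_def
    by (intro exI[of _ y]) (auto simp: y_def)
qed

text \<open>The derivative of the characteristic polynomial is the sum of the characteristic polynomials
  of the principal submatrices, and a combination of \<open>x\<close> and \<open>y\<close> vanishing at the deleted
  index shows that \<open>c\<close> is a root of each of them.\<close>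

lemma two_eigenvectors_imp_multiplicity:
  assumes A: "A \<in> carrier_mat n n"
    and x: "eigenvector A x c" and y: "eigenvector A y c"
    and ind: "\<And>a b. a \<cdot>\<^sub>v x + b \<cdot>\<^sub>v y = 0\<^sub>v n \<Longrightarrow> a = 0 \<and> b = 0"
  shows "2 \<le> eigenvalue_multiplicity A c"
proof -
  have xc: "x \<in> carrier_vec n" and yc: "y \<in> carrier_vec n"
    and Ax: "A *\<^sub>v x = c \<cdot>\<^sub>v x" and Ay: "A *\<^sub>v y = c \<cdot>\<^sub>v y"
    using x y A by (auto simp: eigenvector_def)
  have "eigenvalue A c" using x by (auto simp: eigenvalue_def)
  hence root: "poly (char_poly A) c = 0" and n: "0 < n"
    using eigenvalue_root_char_poly[OF A] eigenvalue_imp_nonzero_dim[OF A] by auto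
  have "poly (char_poly (mat_delete A i i)) c = 0" if i: "i < n" for i
  proof -
    \<comment> \<open>A nontrivial combination of x and y whose entry i vanishes; independence makes
      it an eigenvector.\<close>
    obtain a b where ab: "a * x $ i + b * y $ i = 0" "a \<noteq> 0 \<or> b \<noteq> 0"
    proof (cases "x $ i = 0")
      case True
      thus thesis using that[of 1 0] by simp
    next
      case False
      thus thesis using that[of "y $ i" "- x $ i"] by simp
    qed
    have "eigenvector A (a \<cdot>\<^sub>v x + b \<cdot>\<^sub>v y) c"
      unfolding eigenvector_def using ind ab(2) A xc yc
      by (auto simp: mult_add_distrib_mat_vec[OF A] mult_mat_vec[OF A] Ax Ay
          smult_add_distrib_vec[of _ n] smult_smult_assoc mult.commute)
    moreover have "(a \<cdot>\<^sub>v x + b \<cdot>\<^sub>v y) $ i = 0" using ab(1) i xc yc by simp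
    ultimately have "eigenvalue (mat_delete A i i) c" using eigenvalue_mat_delete[OF A _ i] by blast
    thus ?thesis using eigenvalue_root_char_poly[OF mat_delete_carrier[OF A]] by blast
  qed
  hence d: "poly (pderiv (char_poly A)) c = 0"
    by (simp add: pderiv_char_poly[OF A] poly_sum)
  have p0: "char_poly A \<noteq> 0" and dg: "degree (char_poly A) = n"
    using degree_monic_char_poly[OF A] by auto
  \<comment> \<open>In characteristic 0 the derivative of a polynomial of positive degree is
    nonzero, and differentiation lowers the order of a root by exactly one. A root of both
    polynomials is thus at least double.\<close>
  have pd0: "pderiv (char_poly A) \<noteq> 0" using dg n by (simp add: pderiv_eq_0_iff)
  have "order c (char_poly A) = Suc (order c (pderiv (char_poly A)))"
    using order_pderiv[OF p0 root] .
  moreover have "order c (pderiv (char_poly A)) \<noteq> 0" using d pd0 by (simp add: order_root)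
  ultimately show ?thesis by (simp add: eigenvalue_multiplicity_def)
qed

section \<open>Outer squares and the projection orthogonal to v\<close>

lemma symmetric_matrix_iff:
  assumes "A \<in> carrier_mat n n"
  shows "symmetric_matrix A \<longleftrightarrow> (\<forall>i<n. \<forall>j<n. A $$ (i, j) = A $$ (j, i))"
proof
  assume "symmetric_matrix A"
  thus "\<forall>i<n. \<forall>j<n. A $$ (i, j) = A $$ (j, i)"
    using assms unfolding symmetric_matrix_def by (metis carrier_matD index_transpose_mat(1))
qed (use assms in \<open>auto simp: symmetric_matrix_def\<close>)

lemma outer_square_carrier [simp]: "outer_square n v \<in> carrier_mat n n"
  by (simp add: outer_square_def)

lemma perp_projection_carrier [simp]: "perp_projection n v \<in> carrier_mat n n"
  by (simp add: perp_projection_def minus_carrier_mat)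

lemma smult_mat_mult_vec:
  fixes A :: "'a :: comm_ring_1 mat"
  assumes "A \<in> carrier_mat nr nc" "x \<in> carrier_vec nc"
  shows "(a \<cdot>\<^sub>m A) *\<^sub>v x = a \<cdot>\<^sub>v (A *\<^sub>v x)"
  using assms by (intro eq_vecI) auto

lemma smult_zero_vec [simp]: "a \<cdot>\<^sub>v 0\<^sub>v n = (0\<^sub>v n :: 'a :: mult_zero vec)"
  by (intro eq_vecI) auto

lemma outer_square_mult_vec:
  assumes "v \<in> carrier_vec n" "x \<in> carrier_vec n"
  shows "outer_square n v *\<^sub>v x = (v \<bullet> x) \<cdot>\<^sub>v v"
  using assms
  by (intro eq_vecI) (auto simp: outer_square_def scalar_prod_def sum_distrib_right sum_distrib_left algebra_simps)

lemma mult_outer_square: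
  assumes A: "A \<in> carrier_mat n n" and v: "v \<in> carrier_vec n" and Av: "A *\<^sub>v v = l \<cdot>\<^sub>v v"
  shows "A * outer_square n v = l \<cdot>\<^sub>m outer_square n v"
proof (intro eq_matI)
  fix i j assume "i < dim_row (l \<cdot>\<^sub>m outer_square n v)" "j < dim_col (l \<cdot>\<^sub>m outer_square n v)"
  hence ij: "i < n" "j < n" by (auto simp: outer_square_def)
  have "(A * outer_square n v) $$ (i, j) = (A *\<^sub>v v) $ i * v $ j"
    using ij A v by (simp add: outer_square_def scalar_prod_def sum_distrib_right mult.assoc)
  thus "(A * outer_square n v) $$ (i, j) = (l \<cdot>\<^sub>m outer_square n v) $$ (i, j)"
    using ij v by (simp add: Av outer_square_def)
qed (use A in \<open>auto simp: outer_square_def\<close>)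

lemma outer_square_transpose: "transpose_mat (outer_square n v) = outer_square n v"
  by (intro eq_matI) (auto simp: outer_square_def)

lemma outer_square_mult:
  assumes A: "A \<in> carrier_mat n n" and s: "symmetric_matrix A"
    and v: "v \<in> carrier_vec n" and Av: "A *\<^sub>v v = l \<cdot>\<^sub>v v"
  shows "outer_square n v * A = l \<cdot>\<^sub>m outer_square n v"
proof -
  have "outer_square n v * A = transpose_mat (A * outer_square n v)"
    using s by (simp add: transpose_mult[OF A, of _ n] outer_square_transpose symmetric_matrix_def)
  thus ?thesis
    unfolding mult_outer_square[OF A v Av] by (auto simp: outer_square_def intro!: eq_matI)
qed

text \<open>By symmetry v is a left as well as a right eigenvector. The left projection therefore
  subtracts l v v^T, after which v is in the kernel and the right projection changes
  nothing.\<close>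

lemma perp_projection_sandwich:
  assumes A: "A \<in> carrier_mat n n" and s: "symmetric_matrix A"
    and v: "v \<in> carrier_vec n" and vv: "v \<bullet> v = 1" and Av: "A *\<^sub>v v = l \<cdot>\<^sub>v v"
  shows "perp_projection n v * A * perp_projection n v = A - l \<cdot>\<^sub>m outer_square n v"
proof -
  let ?O = "outer_square n v"
  have O: "?O \<in> carrier_mat n n" by simp
  \<comment> \<open>v is an eigenvector of v v^T for the eigenvalue v^T v = 1.\<close>
  have OO: "?O * ?O = ?O"
    using mult_outer_square[OF O v, of 1] outer_square_mult_vec[OF v v] vv v by auto
  have PA: "perp_projection n v * A = A - l \<cdot>\<^sub>m ?O"
    unfolding perp_projection_def
    using A by (simp add: minus_mult_distrib_mat[of _ n n] outer_square_mult[OF A s v Av])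
  have "(A - l \<cdot>\<^sub>m ?O) * perp_projection n v = A - l \<cdot>\<^sub>m ?O - (l \<cdot>\<^sub>m ?O - l \<cdot>\<^sub>m ?O)"
    unfolding perp_projection_def
    using A by (simp add: minus_carrier_mat right_mult_one_mat[of _ n n]
        mult_minus_distrib_mat[of _ n n _ n] minus_mult_distrib_mat[of _ n n _ _ n]
        mult_outer_square[OF A v Av] mult_smult_assoc_mat[OF O O] OO)
  also have "\<dots> = A - l \<cdot>\<^sub>m ?O"
    using A by (intro eq_matI) (auto simp: outer_square_def)
  finally show ?thesis unfolding PA .
qed

text \<open>Expanding |w - A w|^2 with the two hypotheses gives a value at most 0, so w is a fixed
  point of A.\<close>

lemma eigenvalue_one_if_norm_le:
  fixes A :: "real mat"
  assumes A: "A \<in> carrier_mat n n" and w: "w \<in> carrier_vec n" "w \<noteq> 0\<^sub>v n"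
    and le: "(A *\<^sub>v w) \<bullet> (A *\<^sub>v w) \<le> w \<bullet> w" and eq: "w \<bullet> (A *\<^sub>v w) = w \<bullet> w"
  shows "eigenvalue A 1"
proof -
  have Aw: "A *\<^sub>v w \<in> carrier_vec n" using A w by simp
  have "(w - A *\<^sub>v w) \<bullet> (w - A *\<^sub>v w) \<le> 0"
    unfolding scalar_prod_diff_self[OF w(1) Aw] using le eq by simp
  hence "w - A *\<^sub>v w = 0\<^sub>v n"
    using scalar_prod_self_eq_0_iff[of "w - A *\<^sub>v w" n] scalar_prod_self_nonneg[of "w - A *\<^sub>v w"] w Aw
    by (simp add: order_antisym)
  have "A *\<^sub>v w = w"
  proof (intro eq_vecI)
    fix i assume i: "i < dim_vec w"
    have "(w - A *\<^sub>v w) $ i = 0" using \<open>w - A *\<^sub>v w = 0\<^sub>v n\<close> i w by simp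
    thus "(A *\<^sub>v w) $ i = w $ i" using i w A by simp
  qed (use A w in simp)
  thus ?thesis using w A unfolding eigenvalue_def eigenvector_def by (intro exI[of _ w]) simp
qed

lemma exists_nonzero_orthogonal:
  fixes v :: "real vec"
  assumes v: "v \<in> carrier_vec n" and n: "2 \<le> n"
  obtains w where "w \<in> carrier_vec n" "w \<noteq> 0\<^sub>v n" "v \<bullet> w = 0"
proof (cases "v $ 0 = 0")
  case True
  have "v \<bullet> unit_vec n 0 = 0" using True v n by simp
  thus thesis using that[of "unit_vec n 0"] n by simp
next
  case False
  \<comment> \<open>The first two coordinates of v, rotated by a right angle.\<close>
  define w where "w = v $ 1 \<cdot>\<^sub>v unit_vec n 0 - v $ 0 \<cdot>\<^sub>v unit_vec n 1"
  have w: "w \<in> carrier_vec n" by (simp add: w_def)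
  have "v \<bullet> w = 0" unfolding w_def using v n by (simp add: scalar_prod_minus_distrib[of _ n])
  moreover have "w $ 1 \<noteq> 0" using False n by (simp add: w_def)
  hence "w \<noteq> 0\<^sub>v n" using n by auto
  ultimately show thesis using that[OF w] by blast
qed

section \<open>Comparison of J and K, detached from tensors: K = l (J - P) with J symmetric and J v
  = 0\<close>

context
  fixes n :: nat and v :: "real vec" and l :: real and J K :: "real mat"
  assumes J: "J \<in> carrier_mat n n" and sJ: "symmetric_matrix J"
    and v: "v \<in> carrier_vec n" and vv: "v \<bullet> v = 1" and Jv: "J *\<^sub>v v = 0\<^sub>v n"
    and l: "0 < l" and K: "K = l \<cdot>\<^sub>m J - l \<cdot>\<^sub>m perp_projection n v"
begin

lemma K_carrier: "K \<in> carrier_mat n n"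
  unfolding K by (simp add: minus_carrier_mat)

lemma K_symmetric: "symmetric_matrix K"
proof -
  have "\<forall>i<n. \<forall>j<n. J $$ (i, j) = J $$ (j, i)" using sJ symmetric_matrix_iff[OF J] by blast
  thus ?thesis
    unfolding symmetric_matrix_iff[OF K_carrier] using J
    by (auto simp: K perp_projection_def outer_square_def mult.commute)
qed

lemma K_mult_vec:
  assumes x: "x \<in> carrier_vec n"
  shows "K *\<^sub>v x = l \<cdot>\<^sub>v (J *\<^sub>v x - (x - (v \<bullet> x) \<cdot>\<^sub>v v))"
proof -
  have "perp_projection n v *\<^sub>v x = x - (v \<bullet> x) \<cdot>\<^sub>v v"
    unfolding perp_projection_def using x v
    by (simp add: minus_mult_distrib_mat_vec[of _ n n] outer_square_mult_vec)
  moreover have "K *\<^sub>v x = l \<cdot>\<^sub>v (J *\<^sub>v x) - l \<cdot>\<^sub>v (perp_projection n v *\<^sub>v x)"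
    unfolding K using x J
    by (simp add: minus_mult_distrib_mat_vec[of _ n n] smult_mat_mult_vec[of _ n n])
  ultimately show ?thesis
    using x v J by (intro eq_vecI) (auto simp: algebra_simps)
qed

lemma K_mult_v: "K *\<^sub>v v = 0\<^sub>v n"
  unfolding K_mult_vec[OF v] using v by (intro eq_vecI) (auto simp: vv Jv)

lemma neg_semidef_K:
  assumes rho: "real_spectral_radius J < 1"
  shows "neg_semidef K"
  unfolding neg_semidef_def
proof (intro conjI ballI K_symmetric)
  fix x :: "real vec" assume "x \<in> carrier_vec (dim_row K)"
  hence x: "x \<in> carrier_vec n" using K_carrier by simp
  \<comment> \<open>y = P x differs from x by a multiple of v, which J annihilates and to which J x
    is orthogonal; hence x and y give the same value of the quadratic form of J.\<close>
  define y where "y = x - (v \<bullet> x) \<cdot>\<^sub>v v"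
  have y: "y \<in> carrier_vec n" using x v by (simp add: y_def)
  have Jc: "J *\<^sub>v u \<in> carrier_vec n" if "u \<in> carrier_vec n" for u using J that by simp
  have Jy: "J *\<^sub>v y = J *\<^sub>v x"
    unfolding y_def using x v Jc
    by (auto simp: mult_minus_distrib_mat_vec[OF J] mult_mat_vec[OF J] Jv intro!: eq_vecI)
  have vJx: "v \<bullet> (J *\<^sub>v x) = 0"
    using symmetric_matrix_scalar_prod[OF J sJ v x] x by (simp add: Jv)
  have xy: "x \<bullet> y = y \<bullet> y"
  proof -
    have "v \<bullet> y = 0" using x v by (simp add: y_def scalar_prod_minus_distrib[of _ n] vv)
    thus ?thesis using x v y unfolding y_def[symmetric]
      by (subst (2) y_def) (simp add: minus_scalar_prod_distrib[of _ n])
  qed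
  have yJ: "y \<bullet> (J *\<^sub>v y) = x \<bullet> (J *\<^sub>v x)"
    unfolding Jy using x v Jc vJx by (simp add: y_def minus_scalar_prod_distrib[of _ n])
  \<comment> \<open>Cauchy-Schwarz turns the contraction bound on |J y| into the bound y^T y on the
    quadratic form.\<close>
  have "(y \<bullet> (J *\<^sub>v y))\<^sup>2 \<le> (y \<bullet> y) * ((J *\<^sub>v y) \<bullet> (J *\<^sub>v y))"
    by (rule scalar_prod_Cauchy[OF y Jc[OF y]])
  also have "\<dots> \<le> (y \<bullet> y)\<^sup>2"
    unfolding power2_eq_square
    by (intro mult_left_mono real_spectral_radius_less_1_imp_contraction[OF J sJ rho y]
        scalar_prod_self_nonneg)
  finally have "y \<bullet> (J *\<^sub>v y) \<le> y \<bullet> y"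
    by (rule power2_le_imp_le) (rule scalar_prod_self_nonneg)
  moreover have "x \<bullet> (K *\<^sub>v x) = l * (y \<bullet> (J *\<^sub>v y) - y \<bullet> y)"
    unfolding K_mult_vec[OF x] y_def[symmetric] using x y Jc[OF x]
    by (simp add: scalar_prod_minus_distrib[of _ n] xy yJ)
  ultimately show "x \<bullet> (K *\<^sub>v x) \<le> 0" using l by (simp add: mult_le_0_iff)
qed

text \<open>If the radius were below 1, K would be semidefinite of both signs and its quadratic form
  would vanish. The bound on n supplies a nonzero w orthogonal to v; for n = 1 both J and K are 0,
  so the conclusion fails.\<close>

lemma pos_semidef_K_imp:
  assumes n: "2 \<le> n" and pos: "pos_semidef K"
  shows "1 \<le> real_spectral_radius J"
proof (rule ccontr)
  assume "\<not> ?thesis"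
  hence rho: "real_spectral_radius J < 1" by simp
  obtain w where w: "w \<in> carrier_vec n" "w \<noteq> 0\<^sub>v n" "v \<bullet> w = 0"
    using exists_nonzero_orthogonal[OF v n] .
  have "w \<bullet> (K *\<^sub>v w) = 0"
    using neg_semidef_K[OF rho] pos w(1) K_carrier
    unfolding neg_semidef_def pos_semidef_def by (auto intro: order_antisym)
  moreover have "w \<bullet> (K *\<^sub>v w) = l * (w \<bullet> (J *\<^sub>v w) - w \<bullet> w)"
    unfolding K_mult_vec[OF w(1)] using w v J by (simp add: scalar_prod_minus_distrib[of _ n])
  ultimately have "w \<bullet> (J *\<^sub>v w) = w \<bullet> w" using l by simp
  hence "eigenvalue J 1"
    using eigenvalue_one_if_norm_le[OF J w(1,2)]
      real_spectral_radius_less_1_imp_contraction[OF J sJ rho w(1)] by blast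
  with eigenvalue_abs_le_real_spectral_radius[OF J] rho show False by fastforce
qed

text \<open>An eigenvector for a positive eigenvalue makes the quadratic form of K positive,
  contradicting \<open>neg_semidef_K\<close>.\<close>

lemma indefinite_K_imp:
  assumes ind: "indefinite K"
  shows "1 \<le> real_spectral_radius J"
proof (rule ccontr)
  assume "\<not> ?thesis"
  hence nsd: "neg_semidef K" using neg_semidef_K by simp
  obtain \<mu> x where m: "0 < \<mu>" and x: "x \<in> carrier_vec n" "x \<noteq> 0\<^sub>v n" "K *\<^sub>v x = \<mu> \<cdot>\<^sub>v x"
    using ind K_carrier unfolding indefinite_def eigenvalue_def eigenvector_def by auto
  have "\<mu> * (x \<bullet> x) \<le> 0"
    using nsd x K_carrier unfolding neg_semidef_def by fastforce
  thus False
    using m x scalar_prod_self_eq_0_iff[OF x(1)] scalar_prod_self_nonneg[of x]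
    by (simp add: mult_le_0_iff)
qed

lemma real_spectral_radius_J_less_1:
  assumes mult: "eigenvalue_multiplicity K 0 = 1"
    and ev: "\<And>\<mu>. eigenvalue K \<mu> \<Longrightarrow> \<mu> \<noteq> 0 \<Longrightarrow> - 2 * l < \<mu> \<and> \<mu> < 0"
  shows "real_spectral_radius J < 1"
proof -
  have v0: "v \<noteq> 0\<^sub>v n" using vv by auto
  have n: "0 < n" using v v0 by (cases n) auto
  obtain c where c: "eigenvalue J c" and rho: "real_spectral_radius J = \<bar>c\<bar>"
    using real_spectral_radius_eigenvalue[OF J sJ n] .
  obtain w where w: "w \<in> carrier_vec n" "w \<noteq> 0\<^sub>v n" and Jw: "J *\<^sub>v w = c \<cdot>\<^sub>v w"
    using c J unfolding eigenvalue_def eigenvector_def by auto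
  show ?thesis
  proof (cases "c = 0")
    case False
    \<comment> \<open>v and w are eigenvectors of the symmetric J for the distinct eigenvalues 0 and
      c, hence orthogonal.\<close>
    have "c * (v \<bullet> w) = 0"
      using symmetric_matrix_scalar_prod[OF J sJ v w(1)] v w by (simp add: Jv Jw)
    hence vw: "v \<bullet> w = 0" using False by simp
    have Kw: "K *\<^sub>v w = (l * (c - 1)) \<cdot>\<^sub>v w"
      unfolding K_mult_vec[OF w(1)] Jw vw using w v by (intro eq_vecI) (auto simp: algebra_simps)
    hence e: "eigenvector K w (l * (c - 1))"
      using w K_carrier by (simp add: eigenvector_def)
    have "c \<noteq> 1"
    proof
      assume c1: "c = 1"
      have "2 \<le> eigenvalue_multiplicity K 0"
      proof (rule two_eigenvectors_imp_multiplicity[OF K_carrier, of v _ w])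
        show "eigenvector K v 0"
          using v v0 K_carrier K_mult_v by (auto simp: eigenvector_def)
        show "eigenvector K w 0" using e c1 by simp
        fix a b assume ab: "a \<cdot>\<^sub>v v + b \<cdot>\<^sub>v w = 0\<^sub>v n"
        have "v \<bullet> (a \<cdot>\<^sub>v v + b \<cdot>\<^sub>v w) = a"
          using v w by (simp add: scalar_prod_add_distrib[of _ n] vv vw)
        hence a: "a = 0" using ab v by simp
        have "w \<bullet> (a \<cdot>\<^sub>v v + b \<cdot>\<^sub>v w) = b * (w \<bullet> w)"
          using v w a by (simp add: scalar_prod_add_distrib[of _ n])
        hence "b * (w \<bullet> w) = 0" using ab w by simp
        thus "a = 0 \<and> b = 0" using a scalar_prod_self_eq_0_iff[OF w(1)] w by simp
      qed
      with mult show False by simp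
    qed
    with l have "l * (c - 1) \<noteq> 0" by simp
    moreover have "eigenvalue K (l * (c - 1))" using e by (auto simp: eigenvalue_def)
    \<comment> \<open>Both bounds are written with the factor l in front so that it cancels; they
      then say -1 < c < 1.\<close>
    ultimately have "l * (- 2) < l * (c - 1)" "l * (c - 1) < l * 0"
      using ev[of "l * (c - 1)"] by (simp_all add: mult.commute)
    hence "- 2 < c - 1" "c - 1 < 0" using l by (simp_all only: mult_less_cancel_left_pos)
    thus ?thesis unfolding rho by simp
  qed (simp add: rho)
qed

end

section \<open>The matrix of the tensor contraction\<close>

lemma tensor_mat_carrier [simp]: "tensor_mat m p S v \<in> carrier_mat p p"
  by (simp add: tensor_mat_def)

text \<open>Swapping positions 0 and 1 of the index list exchanges row and column index and leaves
  the contracted indices alone.\<close>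

lemma tensor_mat_symmetric:
  assumes S: "symmetric_tensor m p S" and m: "2 \<le> m"
  shows "symmetric_matrix (tensor_mat m p S v)"
  unfolding symmetric_matrix_iff[OF tensor_mat_carrier]
proof (intro allI impI)
  fix i j assume i: "i < p" and j: "j < p"
  have "S (i # j # is) = S (j # i # is)" if "is": "is \<in> multi_indices (m - 2) p" for "is"
  proof -
    have len: "length (i # j # is) = m" using "is" m by (simp add: multi_indices_def)
    have perm: "Transposition.transpose 0 1 permutes {..<m}"
      using m by (intro permutes_swap_id) auto
    have "i # j # is \<in> multi_indices m p" using "is" i j m by (auto simp: multi_indices_def)
    hence "S (permute_list (Transposition.transpose 0 1) (i # j # is)) = S (i # j # is)"
      using S perm unfolding symmetric_tensor_def by blast
    moreover have "permute_list (Transposition.transpose 0 1) (i # j # is) = j # i # is"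
    proof (rule nth_equalityI)
      fix k assume "k < length (permute_list (Transposition.transpose 0 1) (i # j # is))"
      hence "k < length (i # j # is)" by simp
      thus "permute_list (Transposition.transpose 0 1) (i # j # is) ! k = (j # i # is) ! k"
        using permute_list_nth[of "Transposition.transpose 0 1" "i # j # is" k] perm len
        by (cases k rule: nat.exhaust; cases "k - 1") (auto simp: Transposition.transpose_def)
    qed simp
    ultimately show ?thesis by simp
  qed
  thus "tensor_mat m p S v $$ (i, j) = tensor_mat m p S v $$ (j, i)"
    using i j by (simp add: tensor_mat_def)
qed

lemma multi_indices_Suc:
  "multi_indices (Suc k) p = (\<lambda>(i, is). i # is) ` ({..<p} \<times> multi_indices k p)"
  by (auto simp: multi_indices_def length_Suc_conv image_iff)

text \<open>Multiplying by v contracts the second index; splitting the index lists of length m - 1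
  into head and tail identifies the double sum with the single one.\<close>

lemma tensor_mat_mult_vec:
  assumes v: "v \<in> carrier_vec p" and m: "2 \<le> m"
  shows "tensor_mat m p S v *\<^sub>v v = tensor_vec m p S v"
proof (intro eq_vecI)
  fix i assume "i < dim_vec (tensor_vec m p S v)"
  hence i: "i < p" by (simp add: tensor_vec_def)
  have m1: "m - 1 = Suc (m - 2)" using m by simp
  have inj: "inj_on (\<lambda>(j, is). j # is) ({..<p} \<times> multi_indices (m - 2) p)"
    by (auto simp: inj_on_def)
  have "(tensor_mat m p S v *\<^sub>v v) $ i
      = (\<Sum>j<p. \<Sum>is\<in>multi_indices (m - 2) p. S (i # j # is) * (\<Prod>k\<leftarrow>j # is. v $ k))"
    using i v by (auto simp: tensor_mat_def scalar_prod_def sum_distrib_right atLeast0LessThan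
        intro!: sum.cong)
  also have "\<dots> = tensor_vec m p S v $ i"
    using i unfolding tensor_vec_def m1 multi_indices_Suc sum.reindex[OF inj]
    by (simp add: sum.cartesian_product case_prod_beta)
  finally show "(tensor_mat m p S v *\<^sub>v v) $ i = tensor_vec m p S v $ i" .
qed (simp_all add: tensor_mat_def tensor_vec_def)

theorem lemma16:
  fixes m p :: nat and S :: "nat list \<Rightarrow> real" and l :: real and v :: "real vec"
    and K J :: "real mat"
  assumes "m \<ge> 3"
    and "symmetric_tensor m p S"
    and "tensor_eigenpair m p S l v"
    and "l > 0"
    and "K = perp_projection p v * (real (m - 1) \<cdot>\<^sub>m tensor_mat m p S v - l \<cdot>\<^sub>m 1\<^sub>m p)
               * perp_projection p v"
    and "J = (real (m - 1) / l) \<cdot>\<^sub>m (tensor_mat m p S v - l \<cdot>\<^sub>m outer_square p v)"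
  shows "(p \<ge> 2 \<longrightarrow> pos_semidef K \<longrightarrow> real_spectral_radius J \<ge> 1)
    \<and> (indefinite K \<longrightarrow> real_spectral_radius J \<ge> 1)
    \<and> (neg_semidef K \<and> eigenvalue_multiplicity K 0 = 1
          \<and> (\<forall>\<mu>. eigenvalue K \<mu> \<and> \<mu> \<noteq> 0 \<longrightarrow> \<mu> \<in> {- 2 * l<..<0})
        \<longrightarrow> real_spectral_radius J < 1)
    \<and> (real_spectral_radius J < 1 \<longrightarrow> neg_semidef K)"
proof -
  let ?c = "real (m - 1)" and ?M = "tensor_mat m p S v" and ?O = "outer_square p v"
    and ?P = "perp_projection p v"
  have v: "v \<in> carrier_vec p" and vv: "v \<bullet> v = 1" and Sv: "tensor_vec m p S v = l \<cdot>\<^sub>v v"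
    using assms(3) by (auto simp: tensor_eigenpair_def)
  have M: "?M \<in> carrier_mat p p" and sM: "symmetric_matrix ?M"
    using tensor_mat_symmetric[OF assms(2)] assms(1) by auto
  have Mv: "?M *\<^sub>v v = l \<cdot>\<^sub>v v" using tensor_mat_mult_vec[OF v] assms(1) Sv by simp
  have J: "J \<in> carrier_mat p p" unfolding assms(6) by (simp add: minus_carrier_mat)
  have sJ: "symmetric_matrix J"
    using sM unfolding symmetric_matrix_iff[OF J] symmetric_matrix_iff[OF M]
    by (simp add: assms(6) outer_square_def tensor_mat_def mult.commute)
  have Jv: "J *\<^sub>v v = 0\<^sub>v p"
    unfolding assms(6) using v M
    by (simp add: smult_mat_mult_vec[of _ p p] minus_carrier_mat minus_mult_distrib_mat_vec[of _ p p]
        Mv outer_square_mult_vec vv)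
  \<comment> \<open>The bracket in K. It inherits the eigenvector v, with eigenvalue (m - 1) l - l,
    so the sandwich lemma applies.\<close>
  let ?B = "?c \<cdot>\<^sub>m ?M - l \<cdot>\<^sub>m 1\<^sub>m p"
  have B: "?B \<in> carrier_mat p p" by (simp add: minus_carrier_mat)
  have sB: "symmetric_matrix ?B"
    using sM unfolding symmetric_matrix_iff[OF B] symmetric_matrix_iff[OF M]
    by (simp add: tensor_mat_def)
  have "?B *\<^sub>v v = ?c \<cdot>\<^sub>v (l \<cdot>\<^sub>v v) - l \<cdot>\<^sub>v v"
    using v M
    by (simp add: smult_mat_mult_vec[of _ p p] minus_mult_distrib_mat_vec[of _ p p] Mv)
  hence Bv: "?B *\<^sub>v v = (?c * l - l) \<cdot>\<^sub>v v"
    by (auto simp: left_diff_distrib mult.assoc intro!: eq_vecI)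
  \<comment> \<open>The sandwich is (m - 1) M - l I - ((m - 1) l - l) v v^T with M = S v^(m-2).
    Since l J = (m - 1) M - (m - 1) l v v^T, what remains is -l (I - v v^T).\<close>
  have K: "K = l \<cdot>\<^sub>m J - l \<cdot>\<^sub>m ?P"
    unfolding assms(5) perp_projection_sandwich[OF B sB v vv Bv] unfolding assms(6)
    using assms(4) by (intro eq_matI) (auto simp: carrier_matD[OF M] perp_projection_def outer_square_def algebra_simps)
  note ctx = J sJ v vv Jv assms(4) K
  show ?thesis
    using pos_semidef_K_imp[OF ctx] indefinite_K_imp[OF ctx] neg_semidef_K[OF ctx]
      real_spectral_radius_J_less_1[OF ctx] by auto
qed

end
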